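(* For every integer $m\ge1$ let $I_m$ be the four-neighbor unit-cost grid instance with Manhattan-distance heuristic defined in the context, let $I_m^{T}$ be its transpose with the same successor order (Up, Right, Down, Left), and put $C_m=2m+4$ and $D_m=(m+1)^2+1$. Then $$X_{[h,\mathrm{FIFO}]}(I_m)=C_m,\qquad X_{[h,\mathrm{LIFO}]}(I_m)=C_m+D_m,$$ $$X_{[h,\mathrm{LIFO}]}(I_m^{T})=C_m,\qquad X_{[h,\mathrm{FIFO}]}(I_m^{T})=C_m+D_m.$$ Thus either of the two strategies can incur, relative to the other, an additive expansion gap $D_m=\Theta(m^2)$ and an expansion-count ratio $(C_m+D_m)/C_m=\Theta(m)$; in particular both gaps and ratios are unbounded in both directions.
   Context: **A\* model.** A* runs on a finite directed graph with edge costs, initial state $s$, set of goals, heuristic $h$, and a fixed order in which the successors of each state are generated. Initially OPEN contains only $s$ with $g(s)=0$, and CLOSED is empty. At a selection point let $\mathrm{OPEN}_{\min}$ be the set of $v\in\mathrm{OPEN}$ minimizing $f(v)=g(v)+h(v)$. If $\mathrm{OPEN}_{\min}$ contains a goal, a goal is selected and the search terminates (selecting a goal is not an expansion). Otherwise the tie-breaker selects a non-goal in $\mathrm{OPEN}_{\min}$, which is expanded: it is moved from OPEN to CLOSED and all its successors are generated in the given order. A newly encountered state is inserted into OPEN with a first-insertion timestamp; a strictly smaller tentative $g$ updates an existing OPEN entry's $g$ and parent but keeps its first-insertion timestamp; equal- and higher-cost duplicates are discarded. (The heuristic here is consistent, so states are never reopened.) **Strategies.** $[h,\mathrm{FIFO}]$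 (resp. $[h,\mathrm{LIFO}]$) selects, among the states of $\mathrm{OPEN}_{\min}$ of minimum $h$, the one with the earliest (resp. latest) first-insertion timestamp. $X_\tau(I)$ is the number of non-goal states expanded by strategy $\tau$ on $I$. **Grid $I_m$.** Cells are points $(x,y)\in\{0,\dots,m+2\}^2$. The traversable cells are: - the L-shaped solution corridor $\{(0,y):0\le y\le m+2\}\cup\{(x,m+2):0\le x\le m+2\}$ (each leg has $m+2$ edges); - the cul-de-sac, consisting of its entrance cell $(1,0)$ and the $(m+1)\times(m+1)$ square $\{(x,y):2\le x\le m+2,\ 0\le y\le m\}$. All other cells (namely $(1,y)$ for $1\le y\le m+1$ and $(x,m+1)$ for $2\le x\le m+2$) are blocked. The initial state is $s=(0,0)$ and the unique goal is $G=(m+2,m+2)$. From each traversable cell there is a unit-cost move to each traversable cell at Up $(x,y+1)$, Right $(x+1,y)$, Down $(x,y-1)$, Left $(x-1,y)$, and successors are generated in the order Up, Right, Down, Left. The heuristic is $h(x,y)=|x-(m+2)|+|y-(m+2)|$. **Transpose $I_m^T$.** The instance obtained by replacing the set of traversable cells by its image under $(x,y)\mapsto(y,x)$ (so $s$, $G$, $h$ are unchanged), keeping the successor order Up, Right, Down, Left. *)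

theory Defs
  imports
    Complex_Main
    "HOL-Library.While_Combinator"
    "HOL-Library.Landau_Symbols"
begin

section \<open>A* search\<close>

text \<open>The list \<open>succs I v\<close> enumerates the successors of \<open>v\<close> in the order in which they are
  generated; its elements are the heads of the edges leaving \<open>v\<close>.\<close>

record 'v search_problem =
  verts :: "'v set"
  succs :: "'v \<Rightarrow> 'v list"
  cost :: "'v \<Rightarrow> 'v \<Rightarrow> real"
  start :: 'v
  goals :: "'v set"
  heur :: "'v \<Rightarrow> real"

definition finite_instance :: "'v search_problem \<Rightarrow> bool" where
  "finite_instance I \<longleftrightarrow> finite (verts I) \<and> start I \<in> verts I \<and> goals I \<subseteq> verts I \<and>
     (\<forall>v \<in> verts I. distinct (succs I v) \<and> set (succs I v) \<subseteq> verts I)"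

definition consistent :: "'v search_problem \<Rightarrow> bool" where
  "consistent I \<longleftrightarrow> (\<forall>v \<in> goals I. heur I v = 0) \<and>
     (\<forall>v \<in> verts I. \<forall>u \<in> set (succs I v). heur I v \<le> cost I v u + heur I u)"

text \<open>The entries of \<open>gval\<close>, \<open>parent\<close> and \<open>stamp\<close> are meaningful only for vertices in
  \<open>OPEN \<union> CLOSED\<close>. The value \<open>clock\<close> is the next unused first-insertion timestamp.\<close>

record 'v search_state =
  OPEN :: "'v set"
  CLOSED :: "'v set"
  gval :: "'v \<Rightarrow> real"
  parent :: "'v \<Rightarrow> 'v option"
  stamp :: "'v \<Rightarrow> nat"
  clock :: nat

definition initial_state :: "'v search_problem \<Rightarrow> 'v search_state" where
  "initial_state I = \<lparr>OPEN = {start I}, CLOSED = {}, gval = (\<lambda>_. 0), parent = (\<lambda>_. None),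
     stamp = (\<lambda>_. 0), clock = 1\<rparr>"

definition fval :: "'v search_problem \<Rightarrow> 'v search_state \<Rightarrow> 'v \<Rightarrow> real" where
  "fval I \<sigma> v = gval \<sigma> v + heur I v"

definition OPEN_min :: "'v search_problem \<Rightarrow> 'v search_state \<Rightarrow> 'v set" where
  "OPEN_min I \<sigma> = {v \<in> OPEN \<sigma>. \<forall>u \<in> OPEN \<sigma>. fval I \<sigma> v \<le> fval I \<sigma> u}"

text \<open>Generating \<open>u\<close> as a successor of \<open>v\<close>. Duplicates of closed vertices are always discarded:
  for consistent heuristics they never have a strictly smaller tentative \<open>g\<close>.\<close>

definition generate ::
  "'v search_problem \<Rightarrow> 'v \<Rightarrow> 'v \<Rightarrow> 'v search_state \<Rightarrow> 'v search_state" where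
  "generate I v u \<sigma> =
     (let t = gval \<sigma> v + cost I v u in
      if u \<in> CLOSED \<sigma> then \<sigma>
      else if u \<in> OPEN \<sigma> then
        (if t < gval \<sigma> u
         then \<sigma>\<lparr>gval := (gval \<sigma>)(u := t), parent := (parent \<sigma>)(u := Some v)\<rparr>
         else \<sigma>)
      else \<sigma>\<lparr>OPEN := insert u (OPEN \<sigma>), gval := (gval \<sigma>)(u := t),
             parent := (parent \<sigma>)(u := Some v),
             stamp := (stamp \<sigma>)(u := clock \<sigma>), clock := Suc (clock \<sigma>)\<rparr>)"

definition expand :: "'v search_problem \<Rightarrow> 'v \<Rightarrow> 'v search_state \<Rightarrow> 'v search_state" where
  "expand I v \<sigma> =
     fold (generate I v) (succs I v)
       (\<sigma>\<lparr>OPEN := OPEN \<sigma> - {v}, CLOSED := insert v (CLOSED \<sigma>)\<rparr>)"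

type_synonym 'v strategy = "'v search_problem \<Rightarrow> 'v search_state \<Rightarrow> 'v"

definition running :: "'v search_problem \<Rightarrow> 'v search_state \<Rightarrow> bool" where
  "running I \<sigma> \<longleftrightarrow> OPEN \<sigma> \<noteq> {} \<and> OPEN_min I \<sigma> \<inter> goals I = {}"

text \<open>The final state of the search, or \<open>None\<close> if the search does not terminate.\<close>

definition astar :: "'v strategy \<Rightarrow> 'v search_problem \<Rightarrow> 'v search_state option" where
  "astar \<tau> I = while_option (running I) (\<lambda>\<sigma>. expand I (\<tau> I \<sigma>) \<sigma>) (initial_state I)"

text \<open>Every expansion moves a non-goal vertex to \<open>CLOSED\<close>, which it never leaves, so the vertices
  closed at termination are exactly the expanded ones, each expanded once.\<close>

definition expansions :: "'v strategy \<Rightarrow> 'v search_problem \<Rightarrow> nat" where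
  "expansions \<tau> I = card (CLOSED (the (astar \<tau> I)))"

definition h_minimal :: "'v search_problem \<Rightarrow> 'v search_state \<Rightarrow> 'v set" where
  "h_minimal I \<sigma> = {v \<in> OPEN_min I \<sigma>. \<forall>u \<in> OPEN_min I \<sigma>. heur I v \<le> heur I u}"

definition h_FIFO :: "'v strategy" where
  "h_FIFO I \<sigma> = (ARG_MIN (stamp \<sigma>) v. v \<in> h_minimal I \<sigma>)"

definition h_LIFO :: "'v strategy" where
  "h_LIFO I \<sigma> = (ARG_MAX (stamp \<sigma>) v. v \<in> h_minimal I \<sigma>)"

definition expansion_gap :: "'v strategy \<Rightarrow> 'v strategy \<Rightarrow> 'v search_problem \<Rightarrow> real" where
  "expansion_gap \<tau> \<tau>' I = real (expansions \<tau> I) - real (expansions \<tau>' I)"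

definition expansion_ratio :: "'v strategy \<Rightarrow> 'v strategy \<Rightarrow> 'v search_problem \<Rightarrow> real" where
  "expansion_ratio \<tau> \<tau>' I = real (expansions \<tau> I) / real (expansions \<tau>' I)"

section \<open>Grid instances\<close>

type_synonym cell = "int \<times> int"

text \<open>Up, Right, Down, Left.\<close>

fun neighbours :: "cell \<Rightarrow> cell list" where
  "neighbours (x, y) = [(x, y + 1), (x + 1, y), (x, y - 1), (x - 1, y)]"

definition grid_instance :: "nat \<Rightarrow> cell set \<Rightarrow> cell search_problem" where
  "grid_instance m T =
     \<lparr>verts = T,
      succs = (\<lambda>v. filter (\<lambda>u. u \<in> T) (neighbours v)),
      cost = (\<lambda>_ _. 1),
      start = (0, 0),
      goals = {(int m + 2, int m + 2)},
      heur = (\<lambda>(x, y). real_of_int (\<bar>x - (int m + 2)\<bar> + \<bar>y - (int m + 2)\<bar>))\<rparr>"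

definition corridor :: "nat \<Rightarrow> cell set" where
  "corridor m = {(0, y) | y. 0 \<le> y \<and> y \<le> int m + 2} \<union> {(x, int m + 2) | x. 0 \<le> x \<and> x \<le> int m + 2}"

definition cul_de_sac :: "nat \<Rightarrow> cell set" where
  "cul_de_sac m = {(1, 0)} \<union> {(x, y). 2 \<le> x \<and> x \<le> int m + 2 \<and> 0 \<le> y \<and> y \<le> int m}"

definition traversable :: "nat \<Rightarrow> cell set" where
  "traversable m = corridor m \<union> cul_de_sac m"

definition grid :: "nat \<Rightarrow> cell search_problem" where
  "grid m = grid_instance m (traversable m)"

definition grid_transpose :: "nat \<Rightarrow> cell search_problem" where
  "grid_transpose m = grid_instance m ((\<lambda>(x, y). (y, x)) ` traversable m)"

definition C :: "nat \<Rightarrow> nat" where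
  "C m = 2 * m + 4"

definition D :: "nat \<Rightarrow> nat" where
  "D m = (m + 1)\<^sup>2 + 1"

lemma traversable_subset: "traversable m \<subseteq> {0..int m + 2} \<times> {0..int m + 2}"
  by (auto simp: traversable_def corridor_def cul_de_sac_def)

lemma finite_traversable: "finite (traversable m)"
  by (rule finite_subset[OF traversable_subset]) simp

lemma finite_instance_grid_instance:
  assumes "finite T" "(0, 0) \<in> T" "(int m + 2, int m + 2) \<in> T"
  shows "finite_instance (grid_instance m T)"
  using assms by (auto simp: finite_instance_def grid_instance_def)

lemma finite_instance_grid: "finite_instance (grid m)"
  unfolding grid_def
  by (rule finite_instance_grid_instance[OF finite_traversable])
     (auto simp: traversable_def corridor_def)

lemma finite_instance_grid_transpose: "finite_instance (grid_transpose m)"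
  unfolding grid_transpose_def
  by (rule finite_instance_grid_instance[OF finite_imageI[OF finite_traversable]])
     (force simp: traversable_def corridor_def)+

lemma consistent_grid_instance: "consistent (grid_instance m T)"
  by (auto simp: consistent_def grid_instance_def)

end

theory Submission
  imports Defs "HOL-Real_Asymp.Real_Asymp"
begin

text \<open>Every traversable cell \<open>(x, y)\<close> is reachable by up- and right-moves only, so its distance from
  the start is \<open>x + y\<close> and \<open>f\<close> attains its minimum \<open>2 * m + 4\<close> exactly at the open cells whose
  \<open>g\<close>-value is correct. Among those, minimising \<open>h\<close> means maximising \<open>x + y\<close>. Hence the only choice
  left to the tie-breaker that matters is the first one, between the next corridor cell and the
  entrance of the cul-de-sac, both at distance 1. If it takes the corridor, the search runs straight to
  the goal; if it takes the entrance, the whole cul-de-sac is exhausted first, because the waiting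
  corridor cell has larger \<open>h\<close> than all other cells of the cul-de-sac.\<close>

definition level :: "cell \<Rightarrow> int" where
  "level v = fst v + snd v"

section \<open>Effect of one expansion on the search state\<close>

text \<open>Since \<open>v\<close> is already closed, no step of the fold touches
  \<open>gval \<sigma> v\<close>, so every tentative value is computed from the original state and
  the result is independent of the order of \<open>us\<close>. Repeated entries are harmless because
  \<open>min\<close> is idempotent. Timestamps do depend on the order and are left out; they matter
  only in \<open>first_choice\<close>.\<close>

lemma fold_generate:
  assumes "v \<in> CLOSED \<sigma>"
  shows "CLOSED (fold (generate I v) us \<sigma>) = CLOSED \<sigma> \<and>
         OPEN (fold (generate I v) us \<sigma>) = OPEN \<sigma> \<union> (set us - CLOSED \<sigma>) \<and>
         gval (fold (generate I v) us \<sigma>) =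
           (\<lambda>u. if u \<in> set us - CLOSED \<sigma>
                then if u \<in> OPEN \<sigma> then min (gval \<sigma> u) (gval \<sigma> v + cost I v u)
                     else gval \<sigma> v + cost I v u
                else gval \<sigma> u)"
  using assms
proof (induction us arbitrary: \<sigma>)
  case (Cons u us)
  define \<rho> where "\<rho> = generate I v u \<sigma>"
  have \<rho>: "CLOSED \<rho> = CLOSED \<sigma>" "OPEN \<rho> = OPEN \<sigma> \<union> ({u} - CLOSED \<sigma>)"
    "gval \<rho> = (\<lambda>w. if w = u \<and> u \<notin> CLOSED \<sigma>
                then if u \<in> OPEN \<sigma> then min (gval \<sigma> u) (gval \<sigma> v + cost I v u)
                     else gval \<sigma> v + cost I v u
                else gval \<sigma> w)"
    by (auto simp: \<rho>_def generate_def Let_def fun_eq_iff)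
  have "v \<in> CLOSED \<rho>"
    using Cons.prems \<rho> by simp
  from Cons.IH[OF this] show ?case
    using Cons.prems by (auto simp: \<rho> fun_eq_iff simp flip: \<rho>_def)
qed auto

lemma expand_fields:
  "CLOSED (expand I v \<sigma>) = insert v (CLOSED \<sigma>)"
  "OPEN (expand I v \<sigma>) = (OPEN \<sigma> - {v}) \<union> (set (succs I v) - insert v (CLOSED \<sigma>))"
  "gval (expand I v \<sigma>) =
     (\<lambda>u. if u \<in> set (succs I v) - insert v (CLOSED \<sigma>)
          then if u \<in> OPEN \<sigma> then min (gval \<sigma> u) (gval \<sigma> v + cost I v u)
               else gval \<sigma> v + cost I v u
          else gval \<sigma> u)"
  using fold_generate[of v "\<sigma>\<lparr>OPEN := OPEN \<sigma> - {v}, CLOSED := insert v (CLOSED \<sigma>)\<rparr>" I "succs I v"]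
  by (auto simp: expand_def fun_eq_iff)

section \<open>Selections made by the two tie-breakers\<close>

lemma h_minimal_nonempty:
  assumes "finite (OPEN \<sigma>)" "OPEN \<sigma> \<noteq> {}"
  shows "h_minimal I \<sigma> \<noteq> {}"
proof -
  obtain v where "v \<in> OPEN_min I \<sigma>"
    using ex_min_if_finite[of "fval I \<sigma> ` OPEN \<sigma>"] assms
    by (fastforce simp: OPEN_min_def not_less)
  moreover have "finite (OPEN_min I \<sigma>)"
    using assms by (simp add: OPEN_min_def)
  ultimately show ?thesis
    using ex_min_if_finite[of "heur I ` OPEN_min I \<sigma>"]
    by (fastforce simp: h_minimal_def not_less)
qed

lemma finite_h_minimal: "finite (OPEN \<sigma>) \<Longrightarrow> finite (h_minimal I \<sigma>)"
  by (simp add: h_minimal_def OPEN_min_def)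

lemma h_FIFO_selects:
  assumes "v \<in> h_minimal I \<sigma>"
  shows "h_FIFO I \<sigma> \<in> h_minimal I \<sigma>" "stamp \<sigma> (h_FIFO I \<sigma>) \<le> stamp \<sigma> v"
  using arg_min_natI[of "\<lambda>v. v \<in> h_minimal I \<sigma>", OF assms]
    arg_min_nat_le[of "\<lambda>v. v \<in> h_minimal I \<sigma>", OF assms]
  by (simp_all add: h_FIFO_def)

lemma h_LIFO_selects:
  assumes "v \<in> h_minimal I \<sigma>" "finite (OPEN \<sigma>)"
  shows "h_LIFO I \<sigma> \<in> h_minimal I \<sigma>" "stamp \<sigma> v \<le> stamp \<sigma> (h_LIFO I \<sigma>)"
proof -
  \<comment> \<open>The library facts on \<open>ARG_MAX\<close> over the naturals ask for a strict
    upper bound; the successor of this maximum serves, which is why finiteness is assumed here and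
    not for FIFO.\<close>
  have bound: "\<forall>u. u \<in> h_minimal I \<sigma> \<longrightarrow> stamp \<sigma> u \<le> Max (stamp \<sigma> ` h_minimal I \<sigma>)"
    using finite_h_minimal[OF assms(2)] by simp
  show "h_LIFO I \<sigma> \<in> h_minimal I \<sigma>"
    unfolding h_LIFO_def
    using arg_max_natI[of "\<lambda>v. v \<in> h_minimal I \<sigma>", OF assms(1), of "stamp \<sigma>"] bound
    by (metis le_imp_less_Suc)
  show "stamp \<sigma> v \<le> stamp \<sigma> (h_LIFO I \<sigma>)"
    unfolding h_LIFO_def
    using arg_max_nat_le[of "\<lambda>v. v \<in> h_minimal I \<sigma>", OF assms(1), of "stamp \<sigma>"] bound
    by (metis le_imp_less_Suc)
qed

text \<open>The common part of both strategies. It determines the final set of closed cells once the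
  choice between \<open>c 1\<close> and \<open>e\<close> is fixed. The side conditions on
  \<open>OPEN\<close> guarantee that \<open>h_minimal\<close> is nonempty.\<close>

definition h_tie_breaker :: "'v strategy \<Rightarrow> bool" where
  "h_tie_breaker \<tau> \<longleftrightarrow>
     (\<forall>I \<sigma>. finite (OPEN \<sigma>) \<longrightarrow> OPEN \<sigma> \<noteq> {} \<longrightarrow> \<tau> I \<sigma> \<in> h_minimal I \<sigma>)"

lemma h_tie_breaker_FIFO: "h_tie_breaker h_FIFO"
  unfolding h_tie_breaker_def by (metis ex_in_conv h_FIFO_selects(1) h_minimal_nonempty)

lemma h_tie_breaker_LIFO: "h_tie_breaker h_LIFO"
  unfolding h_tie_breaker_def by (metis ex_in_conv h_LIFO_selects(1) h_minimal_nonempty)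

text \<open>The geometry of \<open>I\<^sub>m\<close> that matters, in a form invariant under transposition: \<open>c k\<close> is the cell
  of the corridor at distance \<open>k\<close>, \<open>K\<close> the cul-de-sac and \<open>e\<close> its entrance.\<close>

locale corridor_and_pocket =
  fixes m :: nat and T :: "cell set" and c :: "nat \<Rightarrow> cell" and K :: "cell set" and e :: cell
  assumes T_eq: "T = c ` {..2 * m + 4} \<union> K"
    and box: "T \<subseteq> {0..int m + 2} \<times> {0..int m + 2}"
    and level_c: "k \<le> 2 * m + 4 \<Longrightarrow> level (c k) = int k"
    and c_first: "c 0 = (0, 0)"
    and c_last: "c (2 * m + 4) = (int m + 2, int m + 2)"
    and c_notin_K: "k \<le> 2 * m + 4 \<Longrightarrow> c k \<notin> K"
    and e_in_K: "e \<in> K"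
    and level_e: "level e = 1"
    and nb_start: "T \<inter> set (neighbours (c 0)) = {c 1, e}"
    and nb_corridor: "1 \<le> k \<Longrightarrow> k < 2 * m + 4 \<Longrightarrow>
      T \<inter> set (neighbours (c k)) = {c (k - 1), c (k + 1)}"
    and nb_pocket: "v \<in> K \<Longrightarrow> T \<inter> set (neighbours v) \<subseteq> insert (c 0) K"
    and pocket_pred: "v \<in> K \<Longrightarrow> v \<noteq> e \<Longrightarrow>
      \<exists>u\<in>K. v \<in> set (neighbours u) \<and> level v = level u + 1"
begin

abbreviation I :: "cell search_problem" where
  "I \<equiv> grid_instance m T"

lemma I_simps [simp]:
  "succs I v = filter (\<lambda>u. u \<in> T) (neighbours v)" "cost I v u = 1"
  "start I = c 0" "goals I = {c (2 * m + 4)}"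
  by (simp_all add: grid_instance_def c_first c_last)

text \<open>Inside the box both absolute values have a fixed sign. Hence \<open>fval\<close> exceeds
  \<open>2 * m + 4\<close> by exactly the amount by which \<open>gval\<close> exceeds the
  level.\<close>

lemma heur_I: "v \<in> T \<Longrightarrow> heur I v = 2 * real m + 4 - of_int (level v)"
  using box by (auto simp: grid_instance_def level_def)

lemma finite_T: "finite T"
  using box by (rule finite_subset) simp

lemma c_in_T: "k \<le> 2 * m + 4 \<Longrightarrow> c k \<in> T"
  by (auto simp: T_eq)

lemma K_subset_T: "K \<subseteq> T"
  by (auto simp: T_eq)

lemma c_eq_iff: "i \<le> 2 * m + 4 \<Longrightarrow> j \<le> 2 * m + 4 \<Longrightarrow> c i = c j \<longleftrightarrow> i = j"
  using level_c by (metis of_nat_eq_iff)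

lemma level_neighbour: "u \<in> set (neighbours v) \<Longrightarrow> level u \<le> level v + 1"
  by (cases v) (auto simp: level_def)

text \<open>The only cell of the box with level below 1 is the start, which lies outside
  \<open>K\<close>; a predecessor inside \<open>K\<close> then adds one more level.\<close>

lemma level_pocket:
  assumes "v \<in> K" "v \<noteq> e"
  shows "2 \<le> level v"
proof -
  have "1 \<le> level u" if "u \<in> K" for u
  proof (rule ccontr)
    assume "\<not> 1 \<le> level u"
    with that box K_subset_T have "u = c 0"
      by (cases u) (force simp: level_def c_first)
    with that c_notin_K[of 0] show False by simp
  qed
  with pocket_pred[OF assms] show ?thesis by force
qed

section \<open>The search invariant\<close>

text \<open>Exactness of \<open>gval\<close> is claimed only for open cells one level above a closed
  neighbour; other open cells merely satisfy the lower bound. The last clause bounds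
  \<open>OPEN\<close> from above by the neighbours of \<open>CLOSED\<close>.\<close>

definition inv :: "cell search_state \<Rightarrow> bool" where
  "inv \<sigma> \<longleftrightarrow> OPEN \<sigma> \<inter> CLOSED \<sigma> = {} \<and> OPEN \<sigma> \<union> CLOSED \<sigma> \<subseteq> T \<and>
     (\<forall>v\<in>OPEN \<sigma>. of_int (level v) \<le> gval \<sigma> v) \<and>
     (\<forall>v\<in>CLOSED \<sigma>. \<forall>u\<in>T \<inter> set (neighbours v). u \<in> OPEN \<sigma> \<union> CLOSED \<sigma> \<and>
        (u \<in> OPEN \<sigma> \<and> level u = level v + 1 \<longrightarrow> gval \<sigma> u = of_int (level u))) \<and>
     (\<forall>u\<in>OPEN \<sigma>. u = c 0 \<or> (\<exists>v\<in>CLOSED \<sigma>. u \<in> set (neighbours v)))"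

lemma inv_parent:
  assumes "inv \<sigma>" "u \<in> OPEN \<sigma>" "u \<noteq> c 0"
  obtains v where "v \<in> CLOSED \<sigma>" "u \<in> set (neighbours v)"
proof -
  have "\<forall>u\<in>OPEN \<sigma>. u = c 0 \<or> (\<exists>v\<in>CLOSED \<sigma>. u \<in> set (neighbours v))"
    using assms(1) unfolding inv_def by (elim conjE)
  with assms that show thesis by blast
qed

lemma inv_initial: "inv (initial_state I)"
  using c_in_T[of 0] level_c[of 0] by (auto simp: inv_def initial_state_def)

text \<open>With an exact value at \<open>v\<close>, each successor is offered
  \<open>level v + 1\<close>, which is never below its level and equals it one level up. So the
  minimum with an old value keeps the lower bound, and keeps or creates exactness.\<close>

lemma inv_expand:
  assumes inv: "inv \<sigma>" and v: "v \<in> OPEN \<sigma>" "gval \<sigma> v = of_int (level v)"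
  shows "inv (expand I v \<sigma>)"
  unfolding inv_def
proof (intro conjI ballI impI)
  note inv = inv[unfolded inv_def]
  let ?\<sigma> = "expand I v \<sigma>"
  show "OPEN ?\<sigma> \<inter> CLOSED ?\<sigma> = {}" "OPEN ?\<sigma> \<union> CLOSED ?\<sigma> \<subseteq> T"
    using inv v by (auto simp: expand_fields)
  show "of_int (level u) \<le> gval ?\<sigma> u" if "u \<in> OPEN ?\<sigma>" for u
  proof -
    have "of_int (level u) \<le> (1 :: real) + of_int (level v)" if "u \<in> set (neighbours v)"
      using level_neighbour[OF that] by linarith
    with that inv v show ?thesis
      by (auto simp: expand_fields algebra_simps)
  qed
  show "u = c 0 \<or> (\<exists>v\<in>CLOSED ?\<sigma>. u \<in> set (neighbours v))" if "u \<in> OPEN ?\<sigma>" for u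
    using that inv v by (auto simp: expand_fields)
  show "u \<in> OPEN ?\<sigma> \<union> CLOSED ?\<sigma>"
    if "w \<in> CLOSED ?\<sigma>" "u \<in> T \<inter> set (neighbours w)" for w u
    using that inv v by (auto simp: expand_fields)
  show "gval ?\<sigma> u = of_int (level u)"
    if "w \<in> CLOSED ?\<sigma>" "u \<in> T \<inter> set (neighbours w)" "u \<in> OPEN ?\<sigma> \<and> level u = level w + 1" for w u
  proof -
    have *: "gval \<sigma> u = of_int (level u)" if "w \<noteq> v" "u \<in> OPEN \<sigma>"
      using that \<open>w \<in> CLOSED ?\<sigma>\<close> \<open>u \<in> T \<inter> _\<close> \<open>u \<in> OPEN ?\<sigma> \<and> _\<close> inv
      by (auto simp: expand_fields)
    have **: "u \<in> OPEN \<sigma>" if "w \<noteq> v"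
      using that \<open>w \<in> CLOSED ?\<sigma>\<close> \<open>u \<in> T \<inter> _\<close> \<open>u \<in> OPEN ?\<sigma> \<and> _\<close> inv
      by (auto simp: expand_fields)
    have ***: "of_int (level u) \<le> (1 :: real) + of_int (level v)" if "u \<in> set (neighbours v)"
      using level_neighbour[OF that] by linarith
    have "of_int (level u) \<le> gval \<sigma> u" if "u \<in> OPEN \<sigma>"
      using that inv by blast
    moreover have "u \<notin> CLOSED \<sigma>" if "w = v"
      using that \<open>u \<in> OPEN ?\<sigma> \<and> _\<close> inv by (auto simp: expand_fields)
    ultimately show ?thesis
      using * ** *** that v by (cases "w = v") (auto simp: expand_fields algebra_simps)
  qed
qed

lemma exact_in_OPEN_min:
  assumes inv: "inv \<sigma>" and w: "w \<in> OPEN \<sigma>" "gval \<sigma> w = of_int (level w)"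
  shows "w \<in> OPEN_min I \<sigma>"
proof -
  have "fval I \<sigma> w \<le> fval I \<sigma> u" if "u \<in> OPEN \<sigma>" for u
    using that w inv heur_I[of u] heur_I[of w] by (force simp: inv_def fval_def)
  with w show ?thesis by (simp add: OPEN_min_def)
qed

text \<open>A single exact open cell \<open>w\<close> pins the minimum of \<open>fval\<close> at
  \<open>2 * m + 4\<close>, so every minimiser is exact; among these, smaller \<open>heur\<close> is
  larger level. Each phase below only has to exhibit a suitable \<open>w\<close>.\<close>

lemma selected_exact:
  assumes inv: "inv \<sigma>" and v: "v \<in> h_minimal I \<sigma>" and w: "w \<in> OPEN \<sigma>" "gval \<sigma> w = of_int (level w)"
  shows "v \<in> OPEN \<sigma>" "gval \<sigma> v = of_int (level v)" "level w \<le> level v"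
proof -
  have fval: "fval I \<sigma> u = gval \<sigma> u + 2 * real m + 4 - of_int (level u)" if "u \<in> OPEN \<sigma>" for u
    using that inv heur_I[of u] by (auto simp: inv_def fval_def)
  have ge: "of_int (level u) \<le> gval \<sigma> u" if "u \<in> OPEN \<sigma>" for u
    using that inv by (auto simp: inv_def)
  show "v \<in> OPEN \<sigma>"
    using v by (auto simp: h_minimal_def OPEN_min_def)
  moreover have "fval I \<sigma> v \<le> fval I \<sigma> w"
    using v w by (auto simp: h_minimal_def OPEN_min_def)
  ultimately show "gval \<sigma> v = of_int (level v)"
    using fval ge w by fastforce
  have "w \<in> OPEN_min I \<sigma>"
    using exact_in_OPEN_min[OF inv w] .
  then have "heur I v \<le> heur I w"
    using v by (auto simp: h_minimal_def)
  moreover have "v \<in> T" "w \<in> T"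
    using \<open>v \<in> OPEN \<sigma>\<close> w inv by (auto simp: inv_def)
  ultimately show "level w \<le> level v"
    by (simp add: heur_I)
qed

section \<open>Walking along the corridor\<close>

text \<open>\<open>k\<close> indexes the next corridor cell and \<open>Q\<close> is the closed part
  of the pocket: nothing or all of it. For \<open>Q = {}\<close> the bound \<open>2 \<le> k\<close>
  puts \<open>c k\<close> at a higher level than the waiting entrance; for \<open>Q = K\<close> the
  cell \<open>c 1\<close> may itself still be waiting.\<close>

definition corridor_phase :: "cell set \<Rightarrow> nat \<Rightarrow> cell search_state \<Rightarrow> bool" where
  "corridor_phase Q k \<sigma> \<longleftrightarrow> inv \<sigma> \<and> k \<le> 2 * m + 4 \<and> CLOSED \<sigma> = c ` {..<k} \<union> Q \<and>
     (Q = {} \<and> 2 \<le> k \<or> Q = K \<and> 1 \<le> k)"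

text \<open>\<open>c k\<close> is not closed and lies one level above the closed cell
  \<open>c (k - 1)\<close>, so the invariant makes it open and exact. Conversely, every open cell
  neighbours a closed one, and the neighbourhoods in the locale leave only \<open>c k\<close> and an
  unvisited \<open>e\<close>.\<close>

lemma corridor_phase_frontier:
  assumes "corridor_phase Q k \<sigma>"
  shows "c k \<in> OPEN \<sigma>" "gval \<sigma> (c k) = of_int (level (c k))"
    "OPEN \<sigma> \<subseteq> {c k, e}" "Q = K \<Longrightarrow> OPEN \<sigma> = {c k}"
proof -
  note ph = assms[unfolded corridor_phase_def]
  note inv = ph[unfolded inv_def]
  have notin: "c k \<notin> CLOSED \<sigma>"
    using ph c_notin_K[of k] by (auto simp: c_eq_iff)
  have "c (k - 1) \<in> CLOSED \<sigma>"
    using ph by auto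
  moreover have "c k \<in> T \<inter> set (neighbours (c (k - 1)))"
  proof (cases "k = 1")
    case False
    with ph have "1 \<le> k - 1" "k - 1 < 2 * m + 4" "k - 1 + 1 = k" by auto
    with nb_corridor[of "k - 1"] show ?thesis by simp
  qed (use nb_start in auto)
  moreover have "level (c k) = level (c (k - 1)) + 1"
    using ph level_c[of k] level_c[of "k - 1"] by auto
  ultimately show "c k \<in> OPEN \<sigma>" "gval \<sigma> (c k) = of_int (level (c k))"
    using inv notin by blast+
  have frontier: "u = c k \<or> u = e \<and> Q \<noteq> K" if "u \<in> OPEN \<sigma>" for u
  proof -
    have k: "k \<le> 2 * m + 4" and closed: "CLOSED \<sigma> = c ` {..<k} \<union> Q" and "inv \<sigma>"
      using ph by simp_all
    have u: "u \<notin> CLOSED \<sigma>" "u \<in> T"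
      using that inv by auto
    have start: "c 0 \<in> CLOSED \<sigma>"
      using ph by auto
    then have "u \<noteq> c 0"
      using u by metis
    with \<open>inv \<sigma>\<close> \<open>u \<in> OPEN \<sigma>\<close> obtain v where v: "v \<in> CLOSED \<sigma>" "u \<in> set (neighbours v)"
      by (rule inv_parent)
    show ?thesis
    proof (cases "v \<in> K")
      case True
      then have "v \<notin> c ` {..<k}"
        using c_notin_K k by auto
      with v closed ph have "Q = K" by blast
      moreover have "u \<in> insert (c 0) K"
        using nb_pocket[OF True] u v by blast
      ultimately show ?thesis
        using u closed start by auto
    next
      case False
      with v closed ph obtain i where i: "v = c i" "i < k" by auto
      have "u = c (i + 1) \<or> u = e \<and> i = 0 \<or> i \<noteq> 0 \<and> u = c (i - 1)"
      proof (cases "i = 0")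
        case True
        with nb_start i v u show ?thesis by auto
      next
        case False
        with nb_corridor[of i] i v u k show ?thesis by auto
      qed
      then show ?thesis
      proof (elim disjE conjE)
        assume "u = c (i + 1)"
        with u closed have "\<not> i + 1 < k" by auto
        with i have "i + 1 = k" by simp
        with \<open>u = c (i + 1)\<close> show ?thesis by simp
      next
        assume "u = e"
        with u closed e_in_K show ?thesis by auto
      next
        assume "u = c (i - 1)"
        with u closed i show ?thesis by auto
      qed
    qed
  qed
  show "OPEN \<sigma> \<subseteq> {c k, e}"
    using frontier by blast
  show "OPEN \<sigma> = {c k}" if "Q = K"
    using frontier \<open>c k \<in> OPEN \<sigma>\<close> that by blast
qed

lemma corridor_phase_running:
  assumes "corridor_phase Q k \<sigma>"
  shows "running I \<sigma> \<longleftrightarrow> k < 2 * m + 4"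
proof -
  note fr = corridor_phase_frontier[OF assms]
  note ph = assms[unfolded corridor_phase_def]
  have "e \<noteq> c (2 * m + 4)"
    using e_in_K c_notin_K by auto
  then have "\<not> k < 2 * m + 4" if "c (2 * m + 4) \<in> OPEN \<sigma>"
    using fr(3) ph that c_eq_iff[of "2 * m + 4" k] by auto
  moreover have "c k \<in> OPEN_min I \<sigma>"
    using exact_in_OPEN_min fr ph by blast
  ultimately show ?thesis
    using ph fr(1) by (cases "k = 2 * m + 4") (auto simp: running_def OPEN_min_def)
qed

lemma corridor_phase_step:
  assumes ph: "corridor_phase Q k \<sigma>" and run: "running I \<sigma>" and \<tau>: "h_tie_breaker \<tau>"
  shows "\<tau> I \<sigma> = c k" "corridor_phase Q (k + 1) (expand I (\<tau> I \<sigma>) \<sigma>)"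
proof -
  note fr = corridor_phase_frontier[OF ph]
  note ph' = ph[unfolded corridor_phase_def]
  have "finite (OPEN \<sigma>)"
    using fr(3) finite_subset by blast
  then have sel: "\<tau> I \<sigma> \<in> h_minimal I \<sigma>"
    using \<tau> fr(1) unfolding h_tie_breaker_def by blast
  have inv: "inv \<sigma>"
    using ph' by blast
  note ex = selected_exact[OF inv sel fr(1,2)]
  show *: "\<tau> I \<sigma> = c k"
  proof (cases "Q = K")
    case True
    with ex(1) fr(4) show ?thesis by auto
  next
    case False
    \<comment> \<open>The rival \<open>e\<close> has level 1, less than the level \<open>k\<close>
      of \<open>c k\<close>, so minimising \<open>h\<close> excludes it.\<close>
    with ph' have "2 \<le> k" by blast
    with ex(1,3) fr(3) level_e level_c[of k] ph' show ?thesis by auto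
  qed
  show "corridor_phase Q (k + 1) (expand I (\<tau> I \<sigma>) \<sigma>)"
    using inv_expand[OF inv ex(1,2)] ph' corridor_phase_running[OF ph] run
    unfolding corridor_phase_def * by (auto simp: expand_fields lessThan_Suc)
qed

section \<open>Exhausting the cul-de-sac\<close>

text \<open>The inclusion is strict so that some pocket cell remains; on equality the state belongs
  to \<open>corridor_phase K 1\<close> instead.\<close>

definition pocket_phase :: "cell search_state \<Rightarrow> bool" where
  "pocket_phase \<sigma> \<longleftrightarrow> inv \<sigma> \<and> {c 0, e} \<subseteq> CLOSED \<sigma> \<and> CLOSED \<sigma> \<subset> insert (c 0) K"

text \<open>Take an unclosed pocket cell of least level. Its predecessor from
  \<open>pocket_pred\<close> must be closed by minimality, so the invariant makes the cell open and
  exact.\<close>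

lemma pocket_phase_frontier:
  assumes "pocket_phase \<sigma>"
  obtains w where "w \<in> OPEN \<sigma>" "gval \<sigma> w = of_int (level w)" "2 \<le> level w"
proof -
  note ph = assms[unfolded pocket_phase_def]
  note inv = ph[unfolded inv_def]
  obtain w0 where "w0 \<in> K - CLOSED \<sigma>"
    using ph by blast
  then obtain w where w: "w \<in> K - CLOSED \<sigma>" and
    least: "\<And>u. u \<in> K - CLOSED \<sigma> \<Longrightarrow> nat (level w) \<le> nat (level u)"
    using ex_has_least_nat[of "\<lambda>u. u \<in> K - CLOSED \<sigma>" w0 "\<lambda>u. nat (level u)"] by blast
  then have "w \<noteq> e"
    using ph by auto
  then have "2 \<le> level w"
    using w level_pocket by blast
  obtain u where u: "u \<in> K" "w \<in> set (neighbours u)" "level w = level u + 1"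
    using pocket_pred w \<open>w \<noteq> e\<close> by blast
  then have "u \<in> CLOSED \<sigma>"
    using least[of u] \<open>2 \<le> level w\<close> by (auto simp: nat_le_eq_zle)
  moreover have "w \<in> T"
    using w K_subset_T by blast
  ultimately have "w \<in> OPEN \<sigma>" "gval \<sigma> w = of_int (level w)"
    using inv u w by blast+
  with \<open>2 \<le> level w\<close> that show thesis by blast
qed

lemma pocket_phase_OPEN:
  assumes "pocket_phase \<sigma>"
  shows "OPEN \<sigma> \<subseteq> insert (c 1) K"
proof
  fix u assume "u \<in> OPEN \<sigma>"
  note ph = assms[unfolded pocket_phase_def]
  note inv = ph[unfolded inv_def]
  have u: "u \<in> T" "u \<noteq> c 0"
    using inv \<open>u \<in> OPEN \<sigma>\<close> by auto
  then obtain v where v: "v \<in> CLOSED \<sigma>" "u \<in> set (neighbours v)"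
    using inv_parent[OF _ \<open>u \<in> OPEN \<sigma>\<close>] ph by metis
  with ph have "v = c 0 \<or> v \<in> K" by blast
  then show "u \<in> insert (c 1) K"
    using nb_start nb_pocket[of v] u v e_in_K by auto
qed

lemma pocket_phase_step:
  assumes ph: "pocket_phase \<sigma>" and \<tau>: "h_tie_breaker \<tau>"
  shows "\<tau> I \<sigma> \<notin> CLOSED \<sigma>" "\<tau> I \<sigma> \<in> T"
    "pocket_phase (expand I (\<tau> I \<sigma>) \<sigma>) \<or> corridor_phase K 1 (expand I (\<tau> I \<sigma>) \<sigma>)"
proof -
  note ph' = ph[unfolded pocket_phase_def]
  have inv: "inv \<sigma>"
    using ph' by blast
  then have "finite (OPEN \<sigma>)"
    using finite_T finite_subset by (auto simp: inv_def)
  obtain w where w: "w \<in> OPEN \<sigma>" "gval \<sigma> w = of_int (level w)" "2 \<le> level w"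
    using pocket_phase_frontier[OF ph] .
  have sel: "\<tau> I \<sigma> \<in> h_minimal I \<sigma>"
    using \<tau> \<open>finite (OPEN \<sigma>)\<close> w(1) unfolding h_tie_breaker_def by blast
  note ex = selected_exact[OF inv sel w(1,2)]
  show "\<tau> I \<sigma> \<notin> CLOSED \<sigma>" "\<tau> I \<sigma> \<in> T"
    using ex inv by (auto simp: inv_def)
  \<comment> \<open>The selected cell has level at least that of \<open>w\<close>, hence at least 2,
    while \<open>c 1\<close> has level 1: the corridor keeps waiting.\<close>
  have "\<tau> I \<sigma> \<noteq> c 1"
    using ex(3) w(3) level_c[of 1] by auto
  then have "\<tau> I \<sigma> \<in> K"
    using ex(1) pocket_phase_OPEN[OF ph] by blast
  then show "pocket_phase (expand I (\<tau> I \<sigma>) \<sigma>) \<or> corridor_phase K 1 (expand I (\<tau> I \<sigma>) \<sigma>)"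
    using inv_expand[OF inv ex(1,2)] ph'
    unfolding pocket_phase_def corridor_phase_def expand_fields by (auto simp: lessThan_Suc)
qed

section \<open>Termination and the final closed set\<close>

text \<open>Each expansion closes a new cell of the finite set \<open>T\<close>, so the number of
  unclosed cells is a termination measure. The phases are preserved, and the only phase state in
  which the loop can stop is the corridor phase with \<open>k = 2 * m + 4\<close>.\<close>

lemma search_from_phase:
  assumes \<sigma>: "pocket_phase \<sigma> \<and> Q = K \<or> corridor_phase Q k \<sigma>" and \<tau>: "h_tie_breaker \<tau>"
  shows "\<exists>\<rho>. while_option (running I) (\<lambda>\<sigma>. expand I (\<tau> I \<sigma>) \<sigma>) \<sigma> = Some \<rho> \<and>
             CLOSED \<rho> = c ` {..<2 * m + 4} \<union> Q"
proof -
  define P where "P \<sigma> \<longleftrightarrow> pocket_phase \<sigma> \<and> Q = K \<or> (\<exists>k. corridor_phase Q k \<sigma>)" for \<sigma>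
  have step: "P (expand I (\<tau> I \<sigma>) \<sigma>) \<and>
      card (T - CLOSED (expand I (\<tau> I \<sigma>) \<sigma>)) < card (T - CLOSED \<sigma>)"
    if "P \<sigma>" "running I \<sigma>" for \<sigma>
  proof -
    have "P (expand I (\<tau> I \<sigma>) \<sigma>) \<and> \<tau> I \<sigma> \<in> T - CLOSED \<sigma>"
      using \<open>P \<sigma>\<close>[unfolded P_def]
    proof (elim disjE conjE exE)
      assume "pocket_phase \<sigma>" "Q = K"
      with pocket_phase_step[OF _ \<tau>] show ?thesis
        unfolding P_def by blast
    next
      fix k assume ph: "corridor_phase Q k \<sigma>"
      have "c k \<in> T - CLOSED \<sigma>"
        using corridor_phase_frontier(1)[OF ph] ph by (auto simp: corridor_phase_def inv_def)
      with corridor_phase_step[OF ph \<open>running I \<sigma>\<close> \<tau>] show ?thesis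
        unfolding P_def by auto
    qed
    moreover from this have "T - CLOSED (expand I (\<tau> I \<sigma>) \<sigma>) \<subset> T - CLOSED \<sigma>"
      by (auto simp: expand_fields)
    ultimately show ?thesis
      using finite_T psubset_card_mono by blast
  qed
  have "P \<sigma>"
    using \<sigma> by (auto simp: P_def)
  then obtain \<rho> where \<rho>: "while_option (running I) (\<lambda>\<sigma>. expand I (\<tau> I \<sigma>) \<sigma>) \<sigma> = Some \<rho>"
    using measure_while_option_Some[of P "running I" "\<lambda>\<sigma>. expand I (\<tau> I \<sigma>) \<sigma>"
        "\<lambda>\<sigma>. card (T - CLOSED \<sigma>)" \<sigma>] step by blast
  have "P \<rho>"
    using while_option_rule[of P, OF _ \<rho> \<open>P \<sigma>\<close>] step by blast
  moreover have stop: "\<not> running I \<rho>"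
    using while_option_stop[OF \<rho>] .
  \<comment> \<open>In the pocket phase some cell is open but the goal is not, so the loop would
    still be running.\<close>
  moreover have "\<not> pocket_phase \<rho>"
  proof
    assume ph: "pocket_phase \<rho>"
    then have "OPEN \<rho> \<noteq> {}"
      using pocket_phase_frontier by blast
    moreover have "c (2 * m + 4) \<notin> OPEN \<rho>"
      using pocket_phase_OPEN[OF ph] c_notin_K[of "2 * m + 4"] c_eq_iff[of "2 * m + 4" 1] by auto
    ultimately show False
      using stop by (auto simp: running_def OPEN_min_def)
  qed
  ultimately obtain k where k: "corridor_phase Q k \<rho>"
    by (auto simp: P_def)
  with stop corridor_phase_running[OF k] have "k = 2 * m + 4"
    by (auto simp: corridor_phase_def)
  with k \<rho> show ?thesis
    by (auto simp: corridor_phase_def)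
qed

section \<open>The first two expansions\<close>

text \<open>The state in which the decisive choice is made; every tie-breaker reaches it because
  initially only the start is open.\<close>

definition after_start :: "cell search_state" where
  "after_start = expand I (c 0) (initial_state I)"

lemma initial_step:
  assumes "h_tie_breaker \<tau>"
  shows "running I (initial_state I)" "\<tau> I (initial_state I) = c 0"
proof -
  show "running I (initial_state I)"
    using c_eq_iff[of 0 "2 * m + 4"] by (auto simp: running_def OPEN_min_def initial_state_def)
  have "\<tau> I (initial_state I) \<in> h_minimal I (initial_state I)"
    using assms unfolding h_tie_breaker_def by (auto simp: initial_state_def)
  then show "\<tau> I (initial_state I) = c 0"
    by (auto simp: h_minimal_def OPEN_min_def initial_state_def)
qed

lemma after_start_fields:
  "OPEN after_start = {c 1, e}" "CLOSED after_start = {c 0}"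
  "gval after_start (c 1) = 1" "gval after_start e = 1" "inv after_start"
proof -
  have ne: "c 1 \<noteq> c 0" "e \<noteq> c 0"
    using c_eq_iff[of 1 0] c_notin_K[of 0] e_in_K by auto
  have succs: "set (succs I (c 0)) = {c 1, e}"
    using nb_start by auto
  show "OPEN after_start = {c 1, e}" "CLOSED after_start = {c 0}"
    "gval after_start (c 1) = 1" "gval after_start e = 1"
    unfolding after_start_def expand_fields succs using ne by (auto simp: initial_state_def)
  show "inv after_start"
    unfolding after_start_def using inv_expand[OF inv_initial, of "c 0"] level_c[of 0]
    by (auto simp: initial_state_def)
qed

text \<open>Both cells have \<open>g\<close> equal to 1 and level 1, so they tie on \<open>f\<close>
  and on \<open>h\<close>, and only the timestamps can separate them.\<close>

lemma h_minimal_after_start: "h_minimal I after_start = {c 1, e}"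
proof -
  have "heur I (c 1) = heur I e"
    using heur_I[of "c 1"] heur_I[of e] c_in_T[of 1] e_in_K K_subset_T level_c[of 1] level_e by auto
  then show ?thesis
    using after_start_fields(3,4) by (auto simp: h_minimal_def OPEN_min_def fval_def after_start_fields(1))
qed

lemma astar_after_second_step:
  assumes \<tau>: "h_tie_breaker \<tau>"
  shows "astar \<tau> I = while_option (running I) (\<lambda>\<sigma>. expand I (\<tau> I \<sigma>) \<sigma>)
    (expand I (\<tau> I after_start) after_start)"
proof -
  have "c (2 * m + 4) \<noteq> c 1" "c (2 * m + 4) \<noteq> e"
    using c_eq_iff[of "2 * m + 4" 1] c_notin_K[of "2 * m + 4"] e_in_K by auto
  then have "running I after_start"
    by (auto simp: running_def OPEN_min_def after_start_fields)
  with initial_step[OF \<tau>] show ?thesis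
    unfolding astar_def
    by (subst while_option_unfold, subst while_option_unfold) (simp add: after_start_def)
qed

lemma card_corridor: "card (c ` {..<2 * m + 4}) = 2 * m + 4"
  by (subst card_image) (auto simp: inj_on_def c_eq_iff)

lemma expansions_corridor_first:
  assumes \<tau>: "h_tie_breaker \<tau>" and first: "\<tau> I after_start = c 1"
  shows "astar \<tau> I \<noteq> None" "expansions \<tau> I = 2 * m + 4"
proof -
  have "inv (expand I (c 1) after_start)"
    using level_c[of 1] by (intro inv_expand after_start_fields(5)) (auto simp: after_start_fields(1,3)[simplified])
  moreover have "c ` {..<2} = {c 1, c 0}"
    by (auto simp: numeral_2_eq_2 lessThan_Suc)
  ultimately have "corridor_phase {} 2 (expand I (c 1) after_start)"
    by (simp add: corridor_phase_def expand_fields after_start_fields)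
  then obtain \<rho> where "astar \<tau> I = Some \<rho>" "CLOSED \<rho> = c ` {..<2 * m + 4}"
    using search_from_phase[of _ "{}" 2, OF _ \<tau>] astar_after_second_step[OF \<tau>] unfolding first
    by fastforce
  then show "astar \<tau> I \<noteq> None" "expansions \<tau> I = 2 * m + 4"
    by (simp_all add: expansions_def card_corridor)
qed

lemma expansions_pocket_first:
  assumes \<tau>: "h_tie_breaker \<tau>" and first: "\<tau> I after_start = e"
  shows "astar \<tau> I \<noteq> None" "expansions \<tau> I = 2 * m + 4 + card K"
proof -
  have "inv (expand I e after_start)"
    using level_e by (intro inv_expand after_start_fields(5)) (auto simp: after_start_fields(1,4))
  \<comment> \<open>The locale does not exclude \<open>K = {e}\<close>, in which case the pocket is
    already exhausted.\<close>
  then have "pocket_phase (expand I e after_start) \<or> corridor_phase K 1 (expand I e after_start)"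
    using e_in_K
    by (auto simp: pocket_phase_def corridor_phase_def expand_fields after_start_fields lessThan_Suc)
  then obtain \<rho> where \<rho>: "astar \<tau> I = Some \<rho>" "CLOSED \<rho> = c ` {..<2 * m + 4} \<union> K"
    using search_from_phase[of _ K 1, OF _ \<tau>] astar_after_second_step[OF \<tau>] unfolding first
    by fastforce
  have "finite K"
    using finite_T K_subset_T finite_subset by blast
  moreover have "c ` {..<2 * m + 4} \<inter> K = {}"
    using c_notin_K by auto
  ultimately have "card (CLOSED \<rho>) = 2 * m + 4 + card K"
    unfolding \<rho> by (subst card_Un_disjoint) (simp_all add: card_corridor)
  with \<rho> show "astar \<tau> I \<noteq> None" "expansions \<tau> I = 2 * m + 4 + card K"
    by (simp_all add: expansions_def)
qed

text \<open>The only place where the successor order enters: Up precedes Right, so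
  \<open>(0, 1)\<close> gets timestamp 1 and \<open>(1, 0)\<close> timestamp 2. The hypothesis
  equates sets, so it leaves open which of the two is the corridor cell and covers both
  orientations.\<close>

lemma first_choice:
  assumes "{c 1, e} = {(0, 1), (1, 0)}"
  shows "h_FIFO I after_start = (0, 1)" "h_LIFO I after_start = (1, 0)"
proof -
  have "{c 1, e} \<subseteq> T"
    using c_in_T[of 1] e_in_K K_subset_T by auto
  then have "{(0, 1), (1, 0)} \<subseteq> T" "(0, -1) \<notin> T" "(-1, 0) \<notin> T"
    unfolding assms using box by auto
  then have "succs I (c 0) = [(0, 1), (1, 0)]"
    by (auto simp: c_first)
  then have stamps: "stamp after_start (0, 1) = 1" "stamp after_start (1, 0) = 2"
    by (simp_all add: after_start_def expand_def generate_def initial_state_def c_first)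
  note hm = h_minimal_after_start[unfolded assms]
  show "h_FIFO I after_start = (0, 1)"
    using h_FIFO_selects[of "(0, 1)" I after_start] stamps by (auto simp: hm)
  show "h_LIFO I after_start = (1, 0)"
    using h_LIFO_selects[of "(1, 0)" I after_start] stamps by (auto simp: hm after_start_fields)
qed

end

section \<open>Invariance under transposition\<close>

text \<open>Reflection preserves the neighbours as a set but not their order, which is why the
  locale assumptions speak only of sets of neighbours.\<close>

lemma set_neighbours_swap: "set (neighbours (prod.swap v)) = prod.swap ` set (neighbours v)"
  by (cases v) auto

lemma level_swap [simp]: "level (prod.swap v) = level v"
  by (simp add: level_def)

lemma corridor_and_pocket_swap:
  assumes "corridor_and_pocket m T c K e"
  shows "corridor_and_pocket m (prod.swap ` T) (prod.swap \<circ> c) (prod.swap ` K) (prod.swap e)"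
proof -
  interpret corridor_and_pocket m T c K e by fact
  have nb: "prod.swap ` T \<inter> set (neighbours (prod.swap v)) = prod.swap ` (T \<inter> set (neighbours v))" for v
    by (simp add: set_neighbours_swap image_Int)
  show ?thesis
  proof
    show "prod.swap ` T = (prod.swap \<circ> c) ` {..2 * m + 4} \<union> prod.swap ` K"
      by (simp add: T_eq image_Un image_comp)
    show "prod.swap ` T \<subseteq> {0..int m + 2} \<times> {0..int m + 2}"
      using box by auto
    show "\<exists>u\<in>prod.swap ` K. v \<in> set (neighbours u) \<and> level v = level u + 1"
      if v: "v \<in> prod.swap ` K" "v \<noteq> prod.swap e" for v
    proof -
      obtain w where w: "v = prod.swap w" "w \<in> K" "w \<noteq> e"
        using v by auto
      then obtain u where "u \<in> K" "w \<in> set (neighbours u)" "level w = level u + 1"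
        using pocket_pred by blast
      with w(1) have "prod.swap u \<in> prod.swap ` K" "v \<in> set (neighbours (prod.swap u))"
        "level v = level (prod.swap u) + 1"
        by (simp_all add: set_neighbours_swap del: swap_simp)
      then show ?thesis by blast
    qed
    show "prod.swap ` T \<inter> set (neighbours v) \<subseteq> insert ((prod.swap \<circ> c) 0) (prod.swap ` K)"
      if v: "v \<in> prod.swap ` K" for v
    proof -
      obtain w where w: "v = prod.swap w" "w \<in> K"
        using v by auto
      show ?thesis
        unfolding w(1) nb using nb_pocket[OF w(2)] by auto
    qed
    show "(prod.swap \<circ> c) 0 = (0, 0)"
      by (simp add: c_first)
  qed (simp_all only: o_apply nb nb_start nb_corridor level_c c_last level_swap level_e
        c_notin_K e_in_K inj_image_mem_iff[OF inj_swap] image_insert image_empty imageI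
        swap_simp not_False_eq_True)
qed

section \<open>The concrete grid\<close>

definition corridor_cell :: "nat \<Rightarrow> nat \<Rightarrow> cell" where
  "corridor_cell m k = (if k \<le> m + 2 then (0, int k) else (int k - int m - 2, int m + 2))"

lemma corridor_eq: "corridor m = corridor_cell m ` {..2 * m + 4}"
proof (intro equalityI subsetI)
  fix v assume "v \<in> corridor m"
  \<comment> \<open>The top-left corner is assigned to the vertical leg, matching the branch
    \<open>k \<le> m + 2\<close> of \<open>corridor_cell\<close>.\<close>
  then consider y where "v = (0, y)" "0 \<le> y" "y \<le> int m + 2"
    | x where "v = (x, int m + 2)" "0 < x" "x \<le> int m + 2"
    by (force simp: corridor_def)
  then show "v \<in> corridor_cell m ` {..2 * m + 4}"
  proof cases
    case 1
    then show ?thesis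
      by (intro image_eqI[of _ _ "nat y"]) (auto simp: corridor_cell_def)
  next
    case 2
    then show ?thesis
      by (intro image_eqI[of _ _ "nat (x + int m + 2)"]) (auto simp: corridor_cell_def)
  qed
qed (auto simp: corridor_def corridor_cell_def split: if_splits)

lemma mem_cul_de_sac:
  "(x, y) \<in> cul_de_sac m \<longleftrightarrow>
     x = 1 \<and> y = 0 \<or> 2 \<le> x \<and> x \<le> int m + 2 \<and> 0 \<le> y \<and> y \<le> int m"
  by (auto simp: cul_de_sac_def)

lemma mem_traversable:
  "(x, y) \<in> traversable m \<longleftrightarrow>
     x = 0 \<and> 0 \<le> y \<and> y \<le> int m + 2 \<or> y = int m + 2 \<and> 0 \<le> x \<and> x \<le> int m + 2 \<or>
     x = 1 \<and> y = 0 \<or> 2 \<le> x \<and> x \<le> int m + 2 \<and> 0 \<le> y \<and> y \<le> int m"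
  by (auto simp: traversable_def corridor_def cul_de_sac_def)

lemma corridor_and_pocket_traversable:
  "corridor_and_pocket m (traversable m) (corridor_cell m) (cul_de_sac m) (1, 0)"
proof
  show "traversable m = corridor_cell m ` {..2 * m + 4} \<union> cul_de_sac m"
    by (simp add: traversable_def corridor_eq)
  show "traversable m \<subseteq> {0..int m + 2} \<times> {0..int m + 2}"
    by (rule traversable_subset)
  show "traversable m \<inter> set (neighbours (corridor_cell m 0)) = {corridor_cell m 1, (1, 0)}"
    by (auto simp: mem_traversable corridor_cell_def)
  show "traversable m \<inter> set (neighbours (corridor_cell m k)) =
      {corridor_cell m (k - 1), corridor_cell m (k + 1)}" if "1 \<le> k" "k < 2 * m + 4" for k
  proof -
    \<comment> \<open>Vertical leg, corner, horizontal leg.\<close>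
    consider "k < m + 2" | "k = m + 2" | "m + 2 < k" by linarith
    then show ?thesis
      using that
      by cases (simp_all add: mem_traversable corridor_cell_def Int_insert_right of_nat_diff, auto)
  qed
  show "traversable m \<inter> set (neighbours v) \<subseteq> insert (corridor_cell m 0) (cul_de_sac m)"
    if "v \<in> cul_de_sac m" for v
    using that
    by (cases v) (auto simp: mem_traversable mem_cul_de_sac corridor_cell_def)
  show "\<exists>u\<in>cul_de_sac m. v \<in> set (neighbours u) \<and> level v = level u + 1"
    if "v \<in> cul_de_sac m" "v \<noteq> (1, 0)" for v
  proof -
    obtain x y where v: "v = (x, y)" "2 \<le> x" "x \<le> int m + 2" "0 \<le> y" "y \<le> int m"
      using \<open>v \<in> _\<close> \<open>v \<noteq> _\<close> by (auto simp: cul_de_sac_def)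
    show ?thesis
    \<comment> \<open>The predecessor lies to the left on the bottom row, which reaches the entrance
      when \<open>x = 2\<close>, and directly below elsewhere.\<close>
    proof (cases "y = 0")
      case True
      with v show ?thesis
        by (intro bexI[of _ "(x - 1, y)"]) (auto simp: cul_de_sac_def level_def)
    next
      case False
      with v show ?thesis
        by (intro bexI[of _ "(x, y - 1)"]) (auto simp: cul_de_sac_def level_def)
    qed
  qed
qed (auto simp: corridor_cell_def cul_de_sac_def level_def)

lemma card_cul_de_sac: "card (cul_de_sac m) = D m"
proof -
  have "cul_de_sac m = insert (1, 0) ({2..int m + 2} \<times> {0..int m})"
    by (auto simp: cul_de_sac_def)
  then show ?thesis
    by (simp add: D_def card_cartesian_product power2_eq_square nat_add_distrib)
qed

section \<open>Expansion counts and unbounded gaps\<close>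

lemma expansions_grid:
  "astar h_FIFO (grid m) \<noteq> None" "expansions h_FIFO (grid m) = C m"
  "astar h_LIFO (grid m) \<noteq> None" "expansions h_LIFO (grid m) = C m + D m"
proof -
  interpret corridor_and_pocket m "traversable m" "corridor_cell m" "cul_de_sac m" "(1, 0)"
    by (rule corridor_and_pocket_traversable)
  have c1: "corridor_cell m 1 = (0, 1)"
    by (simp add: corridor_cell_def)
  have "h_FIFO I after_start = corridor_cell m 1" "h_LIFO I after_start = (1, 0)"
    using first_choice unfolding c1 by auto
  note first = expansions_corridor_first[OF h_tie_breaker_FIFO this(1)]
    expansions_pocket_first[OF h_tie_breaker_LIFO this(2)]
  then show "astar h_FIFO (grid m) \<noteq> None" "expansions h_FIFO (grid m) = C m"
    "astar h_LIFO (grid m) \<noteq> None" "expansions h_LIFO (grid m) = C m + D m"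
    by (simp_all add: grid_def C_def card_cul_de_sac)
qed

lemma expansions_grid_transpose:
  "astar h_LIFO (grid_transpose m) \<noteq> None" "expansions h_LIFO (grid_transpose m) = C m"
  "astar h_FIFO (grid_transpose m) \<noteq> None" "expansions h_FIFO (grid_transpose m) = C m + D m"
proof -
  interpret corridor_and_pocket m "prod.swap ` traversable m" "prod.swap \<circ> corridor_cell m"
    "prod.swap ` cul_de_sac m" "prod.swap (1, 0)"
    by (intro corridor_and_pocket_swap corridor_and_pocket_traversable)
  \<comment> \<open>The corridor now starts at the later-stamped cell and the entrance is
    \<open>(0, 1)\<close>, so LIFO and FIFO exchange roles.\<close>
  have c1: "(prod.swap \<circ> corridor_cell m) 1 = (1, 0)"
    by (simp add: corridor_cell_def)
  have "h_LIFO I after_start = (prod.swap \<circ> corridor_cell m) 1" "h_FIFO I after_start = prod.swap (1, 0)"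
    using first_choice unfolding c1 by auto
  note first = expansions_corridor_first[OF h_tie_breaker_LIFO this(1)]
    expansions_pocket_first[OF h_tie_breaker_FIFO this(2)]
  moreover have "grid_transpose m = I"
    by (simp add: grid_transpose_def prod.swap_def case_prod_unfold)
  moreover have "card (prod.swap ` cul_de_sac m) = D m"
    by (simp add: card_image card_cul_de_sac)
  ultimately show "astar h_LIFO (grid_transpose m) \<noteq> None" "expansions h_LIFO (grid_transpose m) = C m"
    "astar h_FIFO (grid_transpose m) \<noteq> None" "expansions h_FIFO (grid_transpose m) = C m + D m"
    by (simp_all add: C_def)
qed

lemma gap_unbounded: "\<exists>m\<ge>1. B < real (D m)"
proof -
  have "filterlim (\<lambda>m. real (D m)) at_top sequentially"
    unfolding D_def by real_asymp
  then have "\<forall>\<^sub>F m in sequentially. B < real (D m)"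
    by (simp add: filterlim_at_top_dense)
  then show ?thesis
    using eventually_happens[OF eventually_conj[OF eventually_ge_at_top[of 1]]] by fastforce
qed

text \<open>A quadratic numerator over a linear denominator tends to infinity, so the bound is
  eventually exceeded, in particular at some \<open>m \<ge> 1\<close>.\<close>

lemma ratio_unbounded: "\<exists>m\<ge>1. B < real (C m + D m) / real (C m)"
proof -
  have "filterlim (\<lambda>m. real (C m + D m) / real (C m)) at_top sequentially"
    unfolding C_def D_def by real_asymp
  then have "\<forall>\<^sub>F m in sequentially. B < real (C m + D m) / real (C m)"
    by (simp add: filterlim_at_top_dense)
  then show ?thesis
    using eventually_happens[OF eventually_conj[OF eventually_ge_at_top[of 1]]] by fastforce
qed

theorem mainTheorem2:
  shows "(\<forall>m\<ge>1.
           (\<forall>\<tau> \<in> {h_FIFO, h_LIFO}. astar \<tau> (grid m) \<noteq> None \<and> astar \<tau> (grid_transpose m) \<noteq> None) \<and>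
           expansions h_FIFO (grid m) = C m \<and>
           expansions h_LIFO (grid m) = C m + D m \<and>
           expansions h_LIFO (grid_transpose m) = C m \<and>
           expansions h_FIFO (grid_transpose m) = C m + D m) \<and>
         (\<forall>m\<ge>1.
           expansion_gap h_LIFO h_FIFO (grid m) = real (D m) \<and>
           expansion_gap h_FIFO h_LIFO (grid_transpose m) = real (D m) \<and>
           expansion_ratio h_LIFO h_FIFO (grid m) = real (C m + D m) / real (C m) \<and>
           expansion_ratio h_FIFO h_LIFO (grid_transpose m) = real (C m + D m) / real (C m)) \<and>
         (\<lambda>m. real (D m)) \<in> \<Theta>(\<lambda>m. real m ^ 2) \<and>
         (\<lambda>m. real (C m + D m) / real (C m)) \<in> \<Theta>(\<lambda>m. real m) \<and>
         (\<forall>B::real. \<exists>m\<ge>1. expansion_gap h_LIFO h_FIFO (grid m) > B) \<and>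
         (\<forall>B::real. \<exists>m\<ge>1. expansion_gap h_FIFO h_LIFO (grid_transpose m) > B) \<and>
         (\<forall>B::real. \<exists>m\<ge>1. expansion_ratio h_LIFO h_FIFO (grid m) > B) \<and>
         (\<forall>B::real. \<exists>m\<ge>1. expansion_ratio h_FIFO h_LIFO (grid_transpose m) > B)"
proof -
  have "(\<lambda>m. real (D m)) \<in> \<Theta>(\<lambda>m. real m ^ 2)"
    unfolding D_def by real_asymp
  moreover have "(\<lambda>m. real (C m + D m) / real (C m)) \<in> \<Theta>(\<lambda>m. real m)"
    unfolding C_def D_def by real_asymp
  ultimately show ?thesis
    using gap_unbounded ratio_unbounded
    \<comment> \<open>Deleting \<open>not_None_eq\<close> keeps the termination claims in the form
      in which they were proved, so that they rewrite directly.\<close>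
    by (simp add: expansion_gap_def expansion_ratio_def expansions_grid expansions_grid_transpose
        del: not_None_eq)
qed

end
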